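(* Let $E$ be a spectral measure for $(\Omega,\mathcal{F},\mathcal{H})$, where $(\Omega,\mathcal{F})$ is a measurable space and $\mathcal{H}$ is a separable complex Hilbert space. Then $E$ admits an equivalent control measure, and $\Delta\in\mathcal{F}$ is an $E$-null set if and only if $E(\Delta)=0$.
   Context: Let $\mathcal{B}(\mathcal{H})$ be the set of bounded linear operators from $\mathcal{H}$ to $\mathcal{H}$. A spectral measure for $(\Omega,\mathcal{F},\mathcal{H})$ is a function $E:\mathcal{F}\to\mathcal{B}(\mathcal{H})$ such that: (1) for each $\Delta\in\mathcal{F}$, $E(\Delta)$ is an orthogonal projection on a closed subspace of $\mathcal{H}$; (2) $E(\emptyset)=0$ and $E(\Omega)=\mathrm{Id}_{\mathcal{H}}$; (3) $E(\Delta_1\cap\Delta_2)=E(\Delta_1)E(\Delta_2)$ for all $\Delta_1,\Delta_2\in\mathcal{F}$; (4) for every $x,y\in\mathcal{H}$, the set function $E_{x,y}(\cdot):=(E(\cdot)x,y)_{\mathcal{H}}$ is a (countably additive) complex measure on $\mathcal{F}$. A set $F\in\mathcal{F}$ is $E$-null if $E(G)=0$ for all $G\in\mathcal{F}$ with $G\subseteq F$. A control measure for $E$ is a finite positive (countably additive) measure $\mu$ on $(\Omega,\mathcal{F})$ such that every $\mu$-null set is an $E$-null set; it is equivalent to $E$ if $\mu$ and $E$ have the same null sets. *)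

theory Defs
  imports "HOL-Analysis.Analysis"
begin

text \<open>
  The inner product is linear in the first argument and conjugate-linear in the second.
  The norm axioms inherited from \<^class>\<open>real_normed_vector\<close> are redundant: they follow from
  the formula for the norm in terms of the inner product.
\<close>

class complex_inner = real_normed_vector +
  fixes scaleC :: "complex \<Rightarrow> 'a \<Rightarrow> 'a" (infixr "*\<^sub>C" 75)
    and cinner :: "'a \<Rightarrow> 'a \<Rightarrow> complex"
  assumes scaleC_add_right: "a *\<^sub>C (x + y) = a *\<^sub>C x + a *\<^sub>C y"
    and scaleC_add_left: "(a + b) *\<^sub>C x = a *\<^sub>C x + b *\<^sub>C x"
    and scaleC_scaleC: "a *\<^sub>C (b *\<^sub>C x) = (a * b) *\<^sub>C x"
    and scaleC_one: "1 *\<^sub>C x = x"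
    and scaleR_scaleC: "r *\<^sub>R x = complex_of_real r *\<^sub>C x"
    and cinner_commute: "cinner x y = cnj (cinner y x)"
    and cinner_add_left: "cinner (x + y) z = cinner x z + cinner y z"
    and cinner_scaleC_left: "cinner (a *\<^sub>C x) y = a * cinner x y"
    and cinner_ge_zero: "0 \<le> Re (cinner x x)"
    and cinner_eq_zero_iff: "cinner x x = 0 \<longleftrightarrow> x = 0"
    and norm_eq_sqrt_cinner: "norm x = sqrt (Re (cinner x x))"

class complex_hilbert = complex_inner + complete_space
begin
subclass banach ..
end

instantiation complex :: complex_hilbert
begin

definition scaleC_complex :: "complex \<Rightarrow> complex \<Rightarrow> complex"
  where "scaleC_complex a x = a * x"

definition cinner_complex :: "complex \<Rightarrow> complex \<Rightarrow> complex"
  where "cinner_complex x y = x * cnj y"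

instance
proof
  fix x :: complex
  show "norm x = sqrt (Re (cinner x x))"
    by (simp add: cinner_complex_def cmod_def power2_eq_square)
qed (auto simp: scaleC_complex_def cinner_complex_def algebra_simps scaleR_conv_of_real)

end

definition csubspace :: "'h::complex_inner set \<Rightarrow> bool"
  where "csubspace S \<longleftrightarrow>
    0 \<in> S \<and> (\<forall>x\<in>S. \<forall>y\<in>S. x + y \<in> S) \<and> (\<forall>c. \<forall>x\<in>S. c *\<^sub>C x \<in> S)"

text \<open>The library's \<^const>\<open>bounded_linear\<close> is real-linear only.\<close>

definition bounded_clinear :: "('h::complex_inner \<Rightarrow> 'h) \<Rightarrow> bool"
  where "bounded_clinear T \<longleftrightarrow> bounded_linear T \<and> (\<forall>c x. T (c *\<^sub>C x) = c *\<^sub>C T x)"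

definition orthogonal_projection_on :: "'h::complex_inner set \<Rightarrow> ('h \<Rightarrow> 'h) \<Rightarrow> bool"
  where "orthogonal_projection_on S P \<longleftrightarrow>
    (\<forall>x. P x \<in> S \<and> (\<forall>y\<in>S. cinner (x - P x) y = 0))"

definition complex_measure_on :: "'a set set \<Rightarrow> ('a set \<Rightarrow> complex) \<Rightarrow> bool"
  where "complex_measure_on \<F> m \<longleftrightarrow> m {} = 0 \<and>
    (\<forall>A :: nat \<Rightarrow> 'a set. range A \<subseteq> \<F> \<longrightarrow> disjoint_family A \<longrightarrow>
      (\<lambda>i. m (A i)) sums m (\<Union>i. A i))"

text \<open>Values of \<open>E\<close> outside \<open>\<F>\<close> are unconstrained and never used.\<close>

locale spectral_measure = sigma_algebra \<Omega> \<F>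
  for \<Omega> :: "'a set" and \<F> :: "'a set set" +
  fixes E :: "'a set \<Rightarrow> 'h::complex_hilbert \<Rightarrow> 'h"
  assumes bounded_clinear: "\<Delta> \<in> \<F> \<Longrightarrow> bounded_clinear (E \<Delta>)"
    and projection: "\<Delta> \<in> \<F> \<Longrightarrow>
      \<exists>S. csubspace S \<and> closed S \<and> orthogonal_projection_on S (E \<Delta>)"
    and empty: "E {} = (\<lambda>x. 0)"
    and whole: "E \<Omega> = id"
    and Int: "\<Delta>\<^sub>1 \<in> \<F> \<Longrightarrow> \<Delta>\<^sub>2 \<in> \<F> \<Longrightarrow> E (\<Delta>\<^sub>1 \<inter> \<Delta>\<^sub>2) = E \<Delta>\<^sub>1 \<circ> E \<Delta>\<^sub>2"
    and complex_measure: "complex_measure_on \<F> (\<lambda>\<Delta>. cinner (E \<Delta> x) y)"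

definition spectral_null_sets :: "'a set set \<Rightarrow> ('a set \<Rightarrow> 'h::complex_hilbert \<Rightarrow> 'h) \<Rightarrow> 'a set set"
  where "spectral_null_sets \<F> E = {F \<in> \<F>. \<forall>G\<in>\<F>. G \<subseteq> F \<longrightarrow> E G = (\<lambda>x. 0)}"

definition control_measure ::
    "'a set \<Rightarrow> 'a set set \<Rightarrow> ('a set \<Rightarrow> 'h::complex_hilbert \<Rightarrow> 'h) \<Rightarrow> 'a measure \<Rightarrow> bool"
  where "control_measure \<Omega> \<F> E \<mu> \<longleftrightarrow>
    space \<mu> = \<Omega> \<and> sets \<mu> = \<F> \<and> finite_measure \<mu> \<and> null_sets \<mu> \<subseteq> spectral_null_sets \<F> E"

definition equivalent_control_measure ::
    "'a set \<Rightarrow> 'a set set \<Rightarrow> ('a set \<Rightarrow> 'h::complex_hilbert \<Rightarrow> 'h) \<Rightarrow> 'a measure \<Rightarrow> bool"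
  where "equivalent_control_measure \<Omega> \<F> E \<mu> \<longleftrightarrow>
    control_measure \<Omega> \<F> E \<mu> \<and> null_sets \<mu> = spectral_null_sets \<F> E"

end

theory Submission
  imports Defs
begin

text \<open>
  Since \<open>(E(\<Delta>)x, x) = \<parallel>E(\<Delta>)x\<parallel>\<^sup>2\<close>, each \<open>x\<close> gives the finite positive measure \<open>\<Delta> \<mapsto> \<parallel>E(\<Delta>)x\<parallel>\<^sup>2\<close>. For a
  dense sequence \<open>d\<close>, a weighted sum of the measures belonging to the \<open>d n\<close> is finite and vanishes
  at \<open>\<Delta>\<close> precisely when \<open>E(\<Delta>)\<close> vanishes on a dense set, that is, when \<open>E(\<Delta>) = 0\<close>. By
  multiplicativity \<open>E(\<Delta>) = 0\<close> forces \<open>E(G) = E(G)E(\<Delta>) = 0\<close> for all \<open>G \<subseteq> \<Delta>\<close>.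
\<close>

lemma cinner_diff_left: "cinner (x - y) z = cinner x z - cinner y z"
  using cinner_add_left[of "x - y" y z] by (simp add: algebra_simps)

lemma Re_cinner_self: "Re (cinner x x) = (norm x)\<^sup>2"
  by (simp add: norm_eq_sqrt_cinner cinner_ge_zero)

text \<open>The residual \<open>x - P x\<close> is orthogonal to \<open>P x\<close>, which lies in
  \<open>S\<close>. Swapping the arguments of \<open>cinner\<close> only conjugates, so real parts
  agree.\<close>

lemma orthogonal_projection_on_Re_cinner:
  assumes "orthogonal_projection_on S P"
  shows "Re (cinner (P x) x) = (norm (P x))\<^sup>2"
proof -
  have "cinner (x - P x) (P x) = 0"
    using assms unfolding orthogonal_projection_on_def by blast
  then have "cinner x (P x) = cinner (P x) (P x)"
    by (simp add: cinner_diff_left)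
  then have "Re (cinner (P x) x) = Re (cinner (P x) (P x))"
    using cinner_commute[of "P x" x] by simp
  then show ?thesis
    by (simp add: Re_cinner_self)
qed

lemma separable_space_dense_sequence:
  assumes "separable_space (euclidean :: 'a::topological_space topology)"
  obtains d :: "nat \<Rightarrow> 'a::topological_space" where "closure (range d) = UNIV"
proof -
  obtain U :: "'a set" where U: "countable U" "closure U = UNIV"
    using assms unfolding separable_space_def by auto
  \<comment> \<open>A dense set is nonempty, so it can be enumerated, with repetitions if it is
    finite.\<close>
  then have "range (from_nat_into U) = U"
    by (intro range_from_nat_into) auto
  with U that show ?thesis
    by metis
qed

text \<open>Interchange of sum and integral, with the integral taken over counting measure on the
  naturals.\<close>

lemma suminf_ennreal_commute:
  fixes f :: "nat \<Rightarrow> nat \<Rightarrow> ennreal"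
  shows "(\<Sum>i. \<Sum>n. f i n) = (\<Sum>n. \<Sum>i. f i n)"
  using nn_integral_suminf[of f "count_space UNIV"] by (simp add: nn_integral_count_space_nat)

context spectral_measure
begin

lemma linear: "\<Delta> \<in> \<F> \<Longrightarrow> bounded_linear (E \<Delta>)"
  using bounded_clinear unfolding bounded_clinear_def by blast

lemma Re_cinner: "\<Delta> \<in> \<F> \<Longrightarrow> Re (cinner (E \<Delta> x) x) = (norm (E \<Delta> x))\<^sup>2"
  using projection orthogonal_projection_on_Re_cinner by blast

lemma spectral_null_sets_iff:
  assumes "\<Delta> \<in> \<F>"
  shows "\<Delta> \<in> spectral_null_sets \<F> E \<longleftrightarrow> E \<Delta> = (\<lambda>x. 0)"
proof
  assume zero: "E \<Delta> = (\<lambda>x. 0)"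
  have "E G = (\<lambda>x. 0)" if "G \<in> \<F>" "G \<subseteq> \<Delta>" for G
  proof -
    \<comment> \<open>Multiplicativity applies because
      \<open>G \<inter> \<Delta> = G\<close>.\<close>
    have "E G = E G \<circ> E \<Delta>"
      using Int[OF \<open>G \<in> \<F>\<close> assms] that by (simp add: Int_absorb2)
    then show ?thesis
      using zero linear_simps(3)[OF linear[OF \<open>G \<in> \<F>\<close>]] by (simp add: comp_def)
  qed
  then show "\<Delta> \<in> spectral_null_sets \<F> E"
    using assms by (simp add: spectral_null_sets_def)
qed (use assms in \<open>auto simp: spectral_null_sets_def\<close>)

text \<open>The kernel of a continuous map is closed, so it contains the closure of
  \<open>D\<close>.\<close>

lemma eq_zero_if_zero_on_dense:
  assumes "\<Delta> \<in> \<F>" "closure D = UNIV" "\<And>x. x \<in> D \<Longrightarrow> E \<Delta> x = 0"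
  shows "E \<Delta> = (\<lambda>x. 0)"
proof -
  have "closed {x. E \<Delta> x = 0}"
    using linear[OF \<open>\<Delta> \<in> \<F>\<close>]
    by (intro closed_Collect_eq linear_continuous_on continuous_on_const)
  then have "closure D \<subseteq> {x. E \<Delta> x = 0}"
    using assms(3) by (intro closure_minimal) auto
  then show ?thesis
    using assms(2) by auto
qed

text \<open>This is countable additivity of the diagonal measure, whose value at \<Delta> is
  \<open>cinner (E \<Delta> x) x\<close>, after passing to real parts.\<close>

lemma sums_norm_square:
  assumes "range A \<subseteq> \<F>" "disjoint_family A"
  shows "(\<lambda>i. (norm (E (A i) x))\<^sup>2) sums (norm (E (\<Union>i. A i) x))\<^sup>2"
proof -
  have "(\<lambda>i. cinner (E (A i) x) x) sums cinner (E (\<Union>i. A i) x) x"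
    using complex_measure[of x x] assms unfolding complex_measure_on_def by blast
  then have "(\<lambda>i. Re (cinner (E (A i) x) x)) sums Re (cinner (E (\<Union>i. A i) x) x)"
    by (rule sums_Re)
  moreover have "(\<Union>i. A i) \<in> \<F>" "A i \<in> \<F>" for i
    using assms(1) by auto
  ultimately show ?thesis
    by (simp add: Re_cinner)
qed

text \<open>Summing in \<open>ennreal\<close> gives the series a value even when it diverges, so
  finiteness can be treated separately from additivity.\<close>

definition weighted_measure :: "(nat \<Rightarrow> real) \<Rightarrow> (nat \<Rightarrow> 'h) \<Rightarrow> 'a measure"
  where "weighted_measure c d =
    measure_of \<Omega> \<F> (\<lambda>\<Delta>. \<Sum>n. ennreal (c n * (norm (E \<Delta> (d n)))\<^sup>2))"

lemma space_weighted_measure: "space (weighted_measure c d) = \<Omega>"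
  by (simp add: weighted_measure_def space_measure_of_conv)

lemma sets_weighted_measure: "sets (weighted_measure c d) = \<F>"
  by (simp add: weighted_measure_def sets_measure_of_eq)

lemma emeasure_weighted_measure:
  assumes "\<And>n. 0 \<le> c n" "\<Delta> \<in> \<F>"
  shows "emeasure (weighted_measure c d) \<Delta> = (\<Sum>n. ennreal (c n * (norm (E \<Delta> (d n)))\<^sup>2))"
  unfolding weighted_measure_def
proof (rule emeasure_measure_of_sigma)
  let ?m = "\<lambda>\<Delta>. \<Sum>n. ennreal (c n * (norm (E \<Delta> (d n)))\<^sup>2)"
  show "sigma_algebra \<Omega> \<F>"
    by (rule sigma_algebra_axioms)
  show "positive \<F> ?m"
    by (simp add: positive_def empty)
  show "countably_additive \<F> ?m"
    unfolding countably_additive_def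
  proof (intro allI impI)
    fix A :: "nat \<Rightarrow> 'a set"
    assume A: "range A \<subseteq> \<F>" "disjoint_family A"
    \<comment> \<open>Additivity holds for each \<open>n\<close> separately; exchanging the two sums
      then carries it over to the whole series.\<close>
    have "(\<Sum>i. ennreal (c n * (norm (E (A i) (d n)))\<^sup>2))
        = ennreal (c n * (norm (E (\<Union>i. A i) (d n)))\<^sup>2)" for n
      using sums_mult[OF sums_norm_square[OF A], of "c n" "d n"] assms(1)
      by (intro suminf_ennreal_eq) auto
    moreover have "(\<Sum>i. \<Sum>n. ennreal (c n * (norm (E (A i) (d n)))\<^sup>2))
        = (\<Sum>n. \<Sum>i. ennreal (c n * (norm (E (A i) (d n)))\<^sup>2))"
      by (rule suminf_ennreal_commute)
    ultimately show "(\<Sum>i. ?m (A i)) = ?m (\<Union>i. A i)"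
      by simp
  qed
qed (rule assms)

text \<open>As \<open>E \<Omega>\<close> is the identity, the total mass is exactly the series
  assumed summable.\<close>

lemma finite_measure_weighted_measure:
  assumes "\<And>n. 0 \<le> c n" "summable (\<lambda>n. c n * (norm (d n))\<^sup>2)"
  shows "finite_measure (weighted_measure c d)"
proof
  have "(\<Sum>n. ennreal (c n * (norm (d n))\<^sup>2)) \<noteq> \<infinity>"
    using assms by (simp add: suminf_ennreal2)
  then show "emeasure (weighted_measure c d) (space (weighted_measure c d)) \<noteq> \<infinity>"
    using assms(1) by (simp add: space_weighted_measure emeasure_weighted_measure whole)
qed

lemma null_sets_weighted_measure:
  assumes "\<And>n. 0 < c n" "closure (range d) = UNIV"
  shows "null_sets (weighted_measure c d) = spectral_null_sets \<F> E"
proof -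
  have "emeasure (weighted_measure c d) \<Delta> = 0 \<longleftrightarrow> \<Delta> \<in> spectral_null_sets \<F> E"
    if "\<Delta> \<in> \<F>" for \<Delta>
  proof -
    \<comment> \<open>A sum of nonnegative terms vanishes only termwise; \<open>\<le> 0\<close>
      appears because \<open>ennreal\<close> sends negative reals to 0.\<close>
    have "emeasure (weighted_measure c d) \<Delta> = 0 \<longleftrightarrow> (\<forall>n. c n * (norm (E \<Delta> (d n)))\<^sup>2 \<le> 0)"
      using assms(1) that by (simp add: emeasure_weighted_measure less_imp_le suminf_eq_zero_iff
          ennreal_eq_0_iff)
    also have "\<dots> \<longleftrightarrow> (\<forall>n. E \<Delta> (d n) = 0)"
      using assms(1) by (simp add: mult_le_cancel_left_pos[of _ _ 0, simplified])
    also have "\<dots> \<longleftrightarrow> E \<Delta> = (\<lambda>x. 0)"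
      using eq_zero_if_zero_on_dense[OF that assms(2)] by auto
    finally show ?thesis
      using spectral_null_sets_iff[OF that] by simp
  qed
  then show ?thesis
    by (auto simp: null_sets_def sets_weighted_measure spectral_null_sets_def)
qed

lemma equivalent_control_measure_exists:
  assumes "separable_space (euclidean :: 'h topology)"
  shows "\<exists>\<mu>. equivalent_control_measure \<Omega> \<F> E \<mu>"
proof -
  obtain d :: "nat \<Rightarrow> 'h" where d: "closure (range d) = UNIV"
    using separable_space_dense_sequence[OF assms] .
  \<comment> \<open>The geometric factor gives convergence, and the denominator absorbs the size of
    \<open>d n\<close>; the added 1 keeps it positive when \<open>d n = 0\<close>.\<close>
  define c :: "nat \<Rightarrow> real" where "c n = (1/2)^n / (1 + (norm (d n))\<^sup>2)" for n
  have pos: "0 < c n" for n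
    by (simp add: c_def add_pos_nonneg)
  have "c n * (norm (d n))\<^sup>2 \<le> (1/2)^n" for n
    unfolding c_def by (simp add: divide_simps add_pos_nonneg)
  then have "summable (\<lambda>n. c n * (norm (d n))\<^sup>2)"
    using pos by (intro summable_comparison_test'[OF summable_geometric[of "1/2 :: real"]])
      (auto simp: abs_mult less_imp_le)
  then show ?thesis
    using finite_measure_weighted_measure[of c d] null_sets_weighted_measure[OF pos d] pos
    unfolding equivalent_control_measure_def control_measure_def
    by (intro exI[of _ "weighted_measure c d"])
      (auto simp: space_weighted_measure sets_weighted_measure less_imp_le)
qed

end

theorem lemma6p1:
  fixes \<Omega> :: "'a set" and \<F> :: "'a set set"
    and E :: "'a set \<Rightarrow> 'h::complex_hilbert \<Rightarrow> 'h"
  assumes "separable_space (euclidean :: 'h topology)"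
    and "spectral_measure \<Omega> \<F> E"
  shows "(\<exists>\<mu>. equivalent_control_measure \<Omega> \<F> E \<mu>) \<and>
    (\<forall>\<Delta>\<in>\<F>. \<Delta> \<in> spectral_null_sets \<F> E \<longleftrightarrow> E \<Delta> = (\<lambda>x. 0))"
proof -
  interpret spectral_measure \<Omega> \<F> E
    by (rule assms(2))
  show ?thesis
    using equivalent_control_measure_exists[OF assms(1)] spectral_null_sets_iff by blast
qed

end
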